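(* For each integer $n\ge 2$ write $N=n-1$, and let $p_n$ and $\varphi$ be the probability densities on $\mathbb{R}$ defined in the context. Then, as $n\to\infty$, $$N\,d_{\rm TV}(p_n,\varphi)\longrightarrow C_{\rm TV}:=\frac{a^3+3a}{2}\,\varphi(a),\qquad a=3^{1/4}.$$ Numerically, $C_{\rm TV}\approx 0.522516163$.
   Context: $\varphi(y)=(2\pi)^{-1/2}e^{-y^2/2}$ is the standard Gaussian density on $\mathbb{R}$. For probability densities $p,q$ on $\mathbb{R}$, $d_{\rm TV}(p,q)=\frac12\int_{\mathbb{R}}|p(y)-q(y)|\,dy$. For $n\ge2$ and $N=n-1$, let $$h_N(y)=\begin{cases}\left(1-\frac{y^2}{N}\right)^{N/2}, & |y|\le\sqrt N,\\ 0,& |y|>\sqrt N,\end{cases}\qquad D_N=\int_{\mathbb{R}}h_N(y)\,dy,\qquad p_n(y)=\frac{h_N(y)}{D_N}.$$ *)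

theory Defs
  imports "HOL-Probability.Probability"
begin

(* The standard Gaussian density is the library's std_normal_density. *)

definition d_TV :: "(real \<Rightarrow> real) \<Rightarrow> (real \<Rightarrow> real) \<Rightarrow> real" where
  "d_TV p q = (1 / 2) * (LINT y|lborel. \<bar>p y - q y\<bar>)"

(* The exponent N/2 is real, hence powr; at the endpoints y^2 = N the value is 0 powr (N/2) = 0. *)
definition h :: "nat \<Rightarrow> real \<Rightarrow> real" where
  "h N y = (if \<bar>y\<bar> \<le> sqrt (real N) then (1 - y\<^sup>2 / real N) powr (real N / 2) else 0)"

definition D :: "nat \<Rightarrow> real" where
  "D N = (LINT y|lborel. h N y)"

(* Meaningful for n \<ge> 2 only; the subtraction is the truncated one on nat. *)
definition p :: "nat \<Rightarrow> real \<Rightarrow> real" where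
  "p n y = h (n - 1) y / D (n - 1)"

definition C_TV :: real where
  "C_TV = (let a = 3 powr (1 / 4) in (a ^ 3 + 3 * a) / 2 * std_normal_density a)"

end

theory Submission
  imports Defs "HOL-Real_Asymp.Real_Asymp"
begin

text \<open>
  Write \<open>f = h N / sqrt (2 * pi)\<close> and let \<open>\<phi>\<close> be the Gaussian density. From
  \<open>- t - 2 * t\<^sup>2 \<le> ln (1 - t) \<le> - t\<close> with \<open>t = y\<^sup>2 / N\<close> one gets
  \<open>0 \<le> N * (\<phi> - f) \<le> 4 * y ^ 4 * \<phi>\<close>, while pointwise \<open>N * (\<phi> - f)\<close> tends to
  \<open>y ^ 4 * \<phi> / 4\<close>. By dominated convergence and the fourth Gaussian moment 3, the mass of
  \<open>f\<close> is \<open>1 - 3 / (4 * N) + o(1 / N)\<close>. After normalisation the scaled difference tends to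
  \<open>(3 - y ^ 4) * \<phi> / 4\<close>, again under a common integrable bound. Since
  \<open>(y ^ 3 + 3 * y) * \<phi>\<close> is an antiderivative of \<open>(3 - y ^ 4) * \<phi>\<close>, the L1 norm of the limit
  is explicit. For the numerical value, \<open>C_TV\<^sup>2 = (6 * sqrt 3 + 9) / (4 * pi * exp (sqrt 3))\<close>.
\<close>

section \<open>Pointwise comparison of \<open>h\<close> with the Gaussian exponential\<close>

lemma h_measurable [measurable]: "h N \<in> borel_measurable borel"
  unfolding h_def by measurable

lemma h_nonneg: "0 \<le> h N y"
  by (simp add: h_def)

lemma h_eq_exp:
  assumes "0 < N" "y\<^sup>2 < real N"
  shows "h N y = exp (real N / 2 * ln (1 - y\<^sup>2 / real N))"
proof -
  have "\<bar>y\<bar> \<le> sqrt (real N)"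
    using assms(2) by (metis less_imp_le real_le_rsqrt power2_abs)
  moreover have "1 - y\<^sup>2 / real N > 0" using assms by (simp add: field_simps)
  ultimately show ?thesis using assms by (cases "real N = y\<^sup>2") (auto simp: h_def powr_def)
qed

lemma h_eq_0:
  assumes "0 < N" "real N \<le> y\<^sup>2"
  shows "h N y = 0"
proof (cases "y\<^sup>2 = real N")
  case True
  then show ?thesis using assms by (simp add: h_def)
next
  case False
  have "\<not> \<bar>y\<bar> \<le> sqrt (real N)"
  proof
    assume "\<bar>y\<bar> \<le> sqrt (real N)"
    then have "\<bar>y\<bar>\<^sup>2 \<le> (sqrt (real N))\<^sup>2" by (intro power_mono) auto
    with False assms show False by simp
  qed
  then show ?thesis by (simp add: h_def)
qed

lemma h_le_exp:
  assumes "0 < N"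
  shows "h N y \<le> exp (- y\<^sup>2 / 2)"
proof (cases "y\<^sup>2 < real N")
  case True
  have "ln (1 - y\<^sup>2 / real N) \<le> - (y\<^sup>2 / real N)"
    using True assms by (intro ln_one_minus_pos_upper_bound) auto
  then have "real N / 2 * ln (1 - y\<^sup>2 / real N) \<le> real N / 2 * - (y\<^sup>2 / real N)"
    by (intro mult_left_mono) auto
  also have "\<dots> = - y\<^sup>2 / 2" using assms by simp
  finally show ?thesis using h_eq_exp[OF assms True] by simp
next
  case False
  then show ?thesis using h_eq_0[OF assms] by simp
qed

text \<open>Near the origin the logarithmic lower bound gives the estimate with constant 1. In the
  tail, \<open>h\<close> is only bounded below by 0, and \<open>N < 2 * y^2\<close> makes
  \<open>N\<close> itself at most \<open>4 * y^4\<close>; this is where the 4 comes from.\<close>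

lemma exp_minus_h_le:
  "real N * (exp (- y\<^sup>2 / 2) - h N y) \<le> 4 * y ^ 4 * exp (- y\<^sup>2 / 2)"
proof -
  consider "N = 0" | "0 < N" "2 * y\<^sup>2 \<le> real N" | "0 < N" "real N < 2 * y\<^sup>2" by fastforce
  then show ?thesis
  proof cases
    case 1
    then show ?thesis by simp
  next
    case 2
    define t where "t = y\<^sup>2 / real N"
    \<comment> \<open>The case split at \<open>2 * y^2 \<le> N\<close> places \<open>t\<close> in
      the range where \<open>ln (1 - t) \<ge> - t - 2 * t^2\<close> holds.\<close>
    have t: "0 \<le> t" "t \<le> 1 / 2" using 2 by (auto simp: t_def field_simps)
    have less: "y\<^sup>2 < real N"
      using 2 zero_le_power2[of y] by linarith
    have "real N / 2 * ln (1 - t) + y\<^sup>2 / 2 = real N / 2 * (ln (1 - t) + t)"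
      using 2 by (simp add: t_def field_simps)
    also have "\<dots> \<ge> real N / 2 * (- 2 * t\<^sup>2)"
      using ln_one_minus_pos_lower_bound[OF t] by (intro mult_left_mono) auto
    finally have s: "real N / 2 * ln (1 - t) + y\<^sup>2 / 2 \<ge> - (y ^ 4 / real N)"
      using 2 by (simp add: t_def power2_eq_square power4_eq_xxxx)
    have "1 - y ^ 4 / real N \<le> exp (- (y ^ 4 / real N))"
      using exp_ge_add_one_self[of "- (y ^ 4 / real N)"] by simp
    also have "\<dots> \<le> exp (real N / 2 * ln (1 - t) + y\<^sup>2 / 2)"
      using s by simp
    finally have "(1 - y ^ 4 / real N) * exp (- y\<^sup>2 / 2)
        \<le> exp (real N / 2 * ln (1 - t) + y\<^sup>2 / 2) * exp (- y\<^sup>2 / 2)"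
      by (intro mult_right_mono) auto
    also have "\<dots> = h N y"
      using h_eq_exp[OF 2(1) less] by (simp add: t_def mult_exp_exp)
    finally have "exp (- y\<^sup>2 / 2) - h N y \<le> y ^ 4 / real N * exp (- y\<^sup>2 / 2)"
      by (simp add: algebra_simps)
    then have "real N * (exp (- y\<^sup>2 / 2) - h N y) \<le> real N * (y ^ 4 / real N * exp (- y\<^sup>2 / 2))"
      by (intro mult_left_mono) auto
    also have "\<dots> = y ^ 4 * exp (- y\<^sup>2 / 2)" using 2 by simp
    also have "\<dots> \<le> 4 * y ^ 4 * exp (- y\<^sup>2 / 2)" by (intro mult_right_mono) auto
    finally show ?thesis .
  next
    case 3
    \<comment> \<open>Since \<open>1 \<le> N < 2 * y^2\<close>, the number \<open>2 * y^2\<close> is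
      at most its own square.\<close>
    have "1 * (2 * y\<^sup>2) \<le> (2 * y\<^sup>2) * (2 * y\<^sup>2)"
      using 3 by (intro mult_right_mono) auto
    then have N: "real N \<le> 4 * y ^ 4"
      using 3 by (simp add: power2_eq_square power4_eq_xxxx)
    have "real N * (exp (- y\<^sup>2 / 2) - h N y) \<le> real N * exp (- y\<^sup>2 / 2)"
      using h_nonneg by (intro mult_left_mono) auto
    also have "\<dots> \<le> 4 * y ^ 4 * exp (- y\<^sup>2 / 2)"
      using N by (intro mult_right_mono) auto
    finally show ?thesis .
  qed
qed

text \<open>With \<open>c = y^2\<close>, the exponent \<open>N / 2 * ln (1 - c / N)\<close> is
  \<open>- c / 2 - c^2 / (4 * N) + O(1 / N^2)\<close>. Treating \<open>y = 0\<close> apart fixes the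
  sign of \<open>c\<close> for the asymptotic expansion.\<close>

lemma exp_minus_h_tendsto:
  "(\<lambda>N. real N * (exp (- y\<^sup>2 / 2) - h N y)) \<longlonglongrightarrow> y ^ 4 / 4 * exp (- y\<^sup>2 / 2)"
proof (cases "y = 0")
  case True
  then show ?thesis by (simp add: h_def)
next
  case False
  define c where "c = y\<^sup>2"
  have c: "c > 0" using False by (simp add: c_def)
  have "(\<lambda>N. real N * (exp (- c / 2) - exp (real N / 2 * ln (1 - c / real N))))
      \<longlonglongrightarrow> c\<^sup>2 / 4 * exp (- c / 2)"
    using c by (real_asymp simp: power2_eq_square)
  moreover have "eventually (\<lambda>N. real N * (exp (- c / 2) - exp (real N / 2 * ln (1 - c / real N)))
      = real N * (exp (- y\<^sup>2 / 2) - h N y)) sequentially"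
    using eventually_gt_at_top[of "nat \<lceil>c\<rceil>"]
  proof eventually_elim
    case (elim N)
    then have "0 < N" "y\<^sup>2 < real N" by (auto simp: c_def) linarith
    then show ?case using h_eq_exp by (simp add: c_def)
  qed
  ultimately show ?thesis
    by (auto simp: c_def power2_eq_square power4_eq_xxxx mult.assoc intro: Lim_transform_eventually)
qed

section \<open>Gaussian moments and the unnormalised error\<close>

lemma std_normal_fourth_moment:
  "has_bochner_integral lborel (\<lambda>y. y ^ 4 * std_normal_density y) 3"
  \<comment> \<open>The moment of order \<open>2 * k\<close> is
    \<open>(2 * k)! / (2^k * k!)\<close>, here \<open>24 / 8\<close>.\<close>
  using std_normal_moment_even[of 2] by (simp add: fact_numeral mult.commute)

lemma std_normal_total:
  "has_bochner_integral lborel std_normal_density 1"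
  using std_normal_moment_even[of 0] by simp

text \<open>Dividing by \<open>sqrt (2 * pi)\<close> instead of \<open>D N\<close> separates the
  pointwise error from the error in the normalising constant.\<close>

definition scaled_gap :: "nat \<Rightarrow> real \<Rightarrow> real" where
  "scaled_gap N y = real N * (std_normal_density y - h N y / sqrt (2 * pi))"

lemma scaled_gap_measurable [measurable]: "scaled_gap N \<in> borel_measurable borel"
  unfolding scaled_gap_def by measurable

lemma scaled_gap_eq: "scaled_gap N y = real N * (exp (- y\<^sup>2 / 2) - h N y) / sqrt (2 * pi)"
  by (simp add: scaled_gap_def std_normal_density_def diff_divide_distrib right_diff_distrib)

lemma scaled_gap_nonneg: "0 \<le> scaled_gap N y"
  using h_le_exp[of N y] by (cases "N = 0") (auto simp: scaled_gap_eq)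

lemma scaled_gap_le: "scaled_gap N y \<le> 4 * (y ^ 4 * std_normal_density y)"
  using divide_right_mono[OF exp_minus_h_le[of N y], of "sqrt (2 * pi)"]
  by (simp add: scaled_gap_eq std_normal_density_def)

lemma scaled_gap_tendsto: "(\<lambda>N. scaled_gap N y) \<longlonglongrightarrow> y ^ 4 * std_normal_density y / 4"
  using tendsto_divide[OF exp_minus_h_tendsto[of y] tendsto_const[of "sqrt (2 * pi)"]]
  by (simp add: scaled_gap_eq std_normal_density_def mult.commute[of 4])

lemma scaled_gap_integrable: "integrable lborel (scaled_gap N)"
  by (rule Bochner_Integration.integrable_bound[of _ "\<lambda>y. 4 * (y ^ 4 * std_normal_density y)"])
     (use std_normal_fourth_moment scaled_gap_le scaled_gap_nonneg in \<open>auto simp: has_bochner_integral_iff\<close>)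

lemma integral_scaled_gap_tendsto: "(\<lambda>N. LINT y|lborel. scaled_gap N y) \<longlonglongrightarrow> 3 / 4"
proof -
  have "(\<lambda>N. LINT y|lborel. scaled_gap N y) \<longlonglongrightarrow> (LINT y|lborel. y ^ 4 * std_normal_density y / 4)"
    by (rule integral_dominated_convergence[where w = "\<lambda>y. 4 * (y ^ 4 * std_normal_density y)"])
       (use std_normal_fourth_moment scaled_gap_le scaled_gap_nonneg scaled_gap_tendsto in \<open>auto simp: has_bochner_integral_iff\<close>)
  then show ?thesis using std_normal_fourth_moment by (simp add: has_bochner_integral_iff)
qed

section \<open>The normalising constant to first order\<close>

definition mass :: "nat \<Rightarrow> real" where
  "mass N = D N / sqrt (2 * pi)"

lemma mass_eq:
  assumes "0 < N"
  shows "mass N = 1 - (LINT y|lborel. scaled_gap N y) / real N"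
proof -
  have "h N y / sqrt (2 * pi) = std_normal_density y - scaled_gap N y / real N" for y
    using assms by (simp add: scaled_gap_def)
  then have "mass N = (LINT y|lborel. std_normal_density y - scaled_gap N y / real N)"
    by (simp add: mass_def D_def flip: integral_divide_zero)
  also have "\<dots> = 1 - (LINT y|lborel. scaled_gap N y) / real N"
    using std_normal_total scaled_gap_integrable by (simp add: has_bochner_integral_iff)
  finally show ?thesis .
qed

lemma mass_tendsto: "mass \<longlonglongrightarrow> 1"
proof -
  have "(\<lambda>N. 1 - (LINT y|lborel. scaled_gap N y) * (1 / real N)) \<longlonglongrightarrow> 1 - 3 / 4 * 0"
    by (intro tendsto_intros integral_scaled_gap_tendsto lim_const_over_n)
  moreover have "eventually (\<lambda>N. 1 - (LINT y|lborel. scaled_gap N y) * (1 / real N) = mass N) sequentially"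
    using eventually_gt_at_top[of 0] by eventually_elim (simp add: mass_eq)
  ultimately show ?thesis by (simp add: Lim_transform_eventually)
qed

definition scaled_mass_gap :: "nat \<Rightarrow> real" where
  "scaled_mass_gap N = real N * (1 / mass N - 1)"

text \<open>\<open>N * (1 / mass N - 1) = N * (1 - mass N) / mass N\<close>, and
  \<open>N * (1 - mass N)\<close> is the integral of the scaled gap.\<close>

lemma scaled_mass_gap_tendsto: "scaled_mass_gap \<longlonglongrightarrow> 3 / 4"
proof -
  have "(\<lambda>N. (LINT y|lborel. scaled_gap N y) / mass N) \<longlonglongrightarrow> (3 / 4) / 1"
    by (intro tendsto_intros integral_scaled_gap_tendsto mass_tendsto) auto
  moreover have "eventually (\<lambda>N. (LINT y|lborel. scaled_gap N y) / mass N = scaled_mass_gap N) sequentially"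
    \<comment> \<open>The limit 1 makes \<open>mass N\<close> eventually positive, so the fractions
      can be cleared.\<close>
    using eventually_gt_at_top[of 0] order_tendstoD(1)[OF mass_tendsto zero_less_one]
    by eventually_elim (auto simp: scaled_mass_gap_def mass_eq field_simps)
  ultimately show ?thesis by (simp add: Lim_transform_eventually)
qed

text \<open>Valid even if \<open>D N = 0\<close>, as both sides then use \<open>x / 0 = 0\<close>; hence no lower bound on
  the mass is needed below.\<close>
lemma scaled_difference:
  "real N * (p (Suc N) y - std_normal_density y) = scaled_mass_gap N * std_normal_density y - scaled_gap N y / mass N"
proof (cases "D N = 0")
  case True
  then show ?thesis by (simp add: p_def scaled_mass_gap_def scaled_gap_def mass_def)
next
  case False
  then show ?thesis by (simp add: p_def scaled_mass_gap_def scaled_gap_def mass_def field_simps)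
qed

section \<open>Dominated convergence for the normalised densities\<close>

lemma TV_tendsto_integral:
  "(\<lambda>N. real N * d_TV (p (Suc N)) std_normal_density)
     \<longlonglongrightarrow> (LINT y|lborel. \<bar>3 - y ^ 4\<bar> * std_normal_density y) / 8"
proof -
  \<comment> \<open>Convergent sequences are bounded over all indices; \<open>K\<close> and
    \<open>M\<close> serve as coefficients of the dominating function \<open>?w\<close>.\<close>
  obtain K where K: "\<bar>1 / mass N\<bar> \<le> K" for N
    using convergent_imp_Bseq[OF convergentI[OF tendsto_divide[OF tendsto_const[of 1] mass_tendsto]]]
    by (auto simp: Bseq_def)
  obtain M where M: "\<bar>scaled_mass_gap N\<bar> \<le> M" for N
    using convergent_imp_Bseq[OF convergentI[OF scaled_mass_gap_tendsto]] by (auto simp: Bseq_def)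
  let ?w = "\<lambda>y. M * std_normal_density y + K * (4 * (y ^ 4 * std_normal_density y))"
  have "(\<lambda>N. LINT y|lborel. \<bar>scaled_mass_gap N * std_normal_density y - scaled_gap N y / mass N\<bar>)
      \<longlonglongrightarrow> (LINT y|lborel. \<bar>3 / 4 * std_normal_density y - (y ^ 4 * std_normal_density y / 4) / 1\<bar>)"
  proof (rule integral_dominated_convergence[where w = ?w])
    show "integrable lborel ?w"
      using std_normal_fourth_moment std_normal_total by (auto simp: has_bochner_integral_iff)
    show "AE y in lborel. (\<lambda>N. \<bar>scaled_mass_gap N * std_normal_density y - scaled_gap N y / mass N\<bar>)
        \<longlonglongrightarrow> \<bar>3 / 4 * std_normal_density y - (y ^ 4 * std_normal_density y / 4) / 1\<bar>"
      by (intro AE_I2 tendsto_intros scaled_mass_gap_tendsto scaled_gap_tendsto mass_tendsto) auto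
    show "AE y in lborel. norm \<bar>scaled_mass_gap N * std_normal_density y - scaled_gap N y / mass N\<bar> \<le> ?w y" for N
    proof (rule AE_I2)
      fix y
      have "\<bar>scaled_mass_gap N * std_normal_density y\<bar> \<le> M * std_normal_density y"
        using M by (simp add: abs_mult mult_right_mono)
      moreover have "\<bar>scaled_gap N y / mass N\<bar> \<le> K * (4 * (y ^ 4 * std_normal_density y))"
      proof -
        have "\<bar>scaled_gap N y / mass N\<bar> = \<bar>1 / mass N\<bar> * scaled_gap N y"
          using scaled_gap_nonneg[of N y] by simp
        also have "\<dots> \<le> K * (4 * (y ^ 4 * std_normal_density y))"
          using K[of N] order_trans[OF abs_ge_zero K[of N]] scaled_gap_le scaled_gap_nonneg by (intro mult_mono) auto
        finally show ?thesis .
      qed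
      ultimately have "\<bar>scaled_mass_gap N * std_normal_density y - scaled_gap N y / mass N\<bar> \<le> ?w y"
        by (rule order_trans[OF abs_triangle_ineq4 add_mono])
      then show "norm \<bar>scaled_mass_gap N * std_normal_density y - scaled_gap N y / mass N\<bar> \<le> ?w y" by simp
    qed
  qed measurable
  also have "(\<lambda>y. \<bar>3 / 4 * std_normal_density y - (y ^ 4 * std_normal_density y / 4) / 1\<bar>)
      = (\<lambda>y. \<bar>3 - y ^ 4\<bar> * std_normal_density y / 4)"
  proof
    fix y
    have "3 / 4 * std_normal_density y - (y ^ 4 * std_normal_density y / 4) / 1
      = (3 - y ^ 4) * (std_normal_density y / 4)" by (simp add: field_simps)
    then show "\<bar>3 / 4 * std_normal_density y - (y ^ 4 * std_normal_density y / 4) / 1\<bar>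
      = \<bar>3 - y ^ 4\<bar> * std_normal_density y / 4" by (simp only: abs_mult) simp
  qed
  \<comment> \<open>The factor 1/2 of \<open>d_TV\<close> and the 1/4 of the pointwise limit combine
    to the 1/8 of the claim.\<close>
  finally have "(\<lambda>N. (LINT y|lborel. \<bar>scaled_mass_gap N * std_normal_density y - scaled_gap N y / mass N\<bar>) / 2)
      \<longlonglongrightarrow> (LINT y|lborel. \<bar>3 - y ^ 4\<bar> * std_normal_density y / 4) / 2"
    by (intro tendsto_intros) auto
  moreover have "(LINT y|lborel. \<bar>scaled_mass_gap N * std_normal_density y - scaled_gap N y / mass N\<bar>) / 2
      = real N * d_TV (p (Suc N)) std_normal_density" for N
    by (simp add: d_TV_def abs_mult flip: scaled_difference integral_mult_right_zero)
  ultimately show ?thesis by simp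
qed

section \<open>The L1 norm of the limit in closed form\<close>

lemma std_normal_quartic_antiderivative:
  "((\<lambda>y. (y ^ 3 + 3 * y) * std_normal_density y) has_real_derivative
     (3 - y ^ 4) * std_normal_density y) (at y within S)"
proof -
  have "((\<lambda>y. (y ^ 3 + 3 * y) * exp (- y\<^sup>2 / 2)) has_real_derivative
      (3 - y ^ 4) * exp (- y\<^sup>2 / 2)) (at y within S)"
    \<comment> \<open>The exponential contributes the factor \<open>- y\<close>, and
      \<open>3 * y^2 + 3 - y * (y^3 + 3 * y) = 3 - y^4\<close>.\<close>
    by (rule derivative_eq_intros refl | simp)+
       (simp add: algebra_simps power2_eq_square power3_eq_cube power4_eq_xxxx)
  then show ?thesis
    unfolding std_normal_density_def
    by (auto dest: DERIV_cdivide[where c = "sqrt (2 * pi)"])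
qed

lemma integral_abs_quartic:
  fixes a :: real
  assumes "0 \<le> a" "a ^ 4 = 3"
  shows "(LINT y|lborel. \<bar>3 - y ^ 4\<bar> * std_normal_density y) = 4 * (a ^ 3 + 3 * a) * std_normal_density a"
proof -
  let ?g = "\<lambda>y. (3 - y ^ 4) * std_normal_density y"
  have cont: "continuous_on {-a..a} ?g"
    unfolding std_normal_density_def by (intro continuous_intros) auto
  \<comment> \<open>Three times the total mass 1 cancels the fourth moment 3.\<close>
  have I: "has_bochner_integral lborel ?g 0"
    using has_bochner_integral_diff[OF has_bochner_integral_mult_right[OF std_normal_total, of 3]
        std_normal_fourth_moment] by (simp add: left_diff_distrib)
  have J: "(LINT y|lborel. indicator {-a..a} y *\<^sub>R ?g y)
      = (a ^ 3 + 3 * a) * std_normal_density a - ((-a) ^ 3 + 3 * (-a)) * std_normal_density (-a)"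
    using assms(1) cont
    by (intro integral_FTC_atLeastAtMost std_normal_quartic_antiderivative[THEN has_real_derivative_iff_has_vector_derivative[THEN iffD1]]) auto
  have neg: "std_normal_density (- a) = std_normal_density a"
    by (simp add: std_normal_density_def)
  \<comment> \<open>The signed integral vanishes, so only the part over \<open>{-a..a}\<close>, counted twice, survives.\<close>
  have sgn: "\<bar>3 - y ^ 4\<bar> = (2 * indicator {-a..a} y - 1) * (3 - y ^ 4)" for y
  proof -
    have "y ^ 4 \<le> 3 \<longleftrightarrow> \<bar>y\<bar> \<le> a"
      using power_mono_iff[of "\<bar>y\<bar>" a 4] assms by simp
    then show ?thesis by (auto simp: indicator_def abs_le_iff)
  qed
  have "(LINT y|lborel. \<bar>3 - y ^ 4\<bar> * std_normal_density y)
      = (LINT y|lborel. 2 * (indicator {-a..a} y *\<^sub>R ?g y) - ?g y)"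
    unfolding sgn by (simp add: algebra_simps)
  also have "\<dots> = 2 * (LINT y|lborel. indicator {-a..a} y *\<^sub>R ?g y) - (LINT y|lborel. ?g y)"
    using I borel_integrable_atLeastAtMost'[OF cont]
    by (subst Bochner_Integration.integral_diff) (auto simp: has_bochner_integral_iff set_integrable_def)
  also have "(LINT y|lborel. ?g y) = 0" using I by (simp add: has_bochner_integral_iff)
  \<comment> \<open>The antiderivative is odd, so \<open>J\<close> equals
    \<open>2 * (a^3 + 3 * a) * std_normal_density a\<close>; doubling it gives the 4.\<close>
  finally show ?thesis unfolding J neg by (simp add: algebra_simps)
qed

section \<open>Numerical enclosure of \<open>C_TV\<close>\<close>

lemma sqrt3_bounds: "1.7320508075 < sqrt 3" "sqrt 3 < 1.7320508076"
proof -
  show "1.7320508075 < sqrt 3" by (rule real_less_rsqrt) (simp add: power2_eq_square)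
  show "sqrt 3 < 1.7320508076" by (rule real_less_lsqrt) (simp_all add: power2_eq_square)
qed

lemma exp_partial_sum_even_odd:
  fixes x :: real
  shows "(\<Sum>m<2 * n. x ^ m / fact m)
    = (\<Sum>k<n. (x\<^sup>2) ^ k / fact (2 * k)) + x * (\<Sum>k<n. (x\<^sup>2) ^ k / fact (2 * k + 1))"
  by (induction n) (simp_all add: power_mult distrib_left del: fact_Suc)

lemma exp_sqrt3_bounds: "5.652233672 < exp (sqrt 3)" "exp (sqrt 3) < 5.652233675"
proof -
  \<comment> \<open>Splitting the Taylor polynomial at \<open>sqrt 3\<close> into even and odd powers keeps the rationals small.\<close>
  define c where "c = (\<Sum>k<10. 3 ^ k / fact (2 * k) :: real)"
  define d where "d = (\<Sum>k<10. 3 ^ k / fact (2 * k + 1) :: real)"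
  have c: "2.91457744017 < c" "c < 2.91457744018"
    by (simp_all add: c_def lessThan_nat_numeral fact_numeral)
  have d: "1.58058656356 < d" "d < 1.58058656357"
    by (simp_all add: d_def lessThan_nat_numeral fact_numeral)
  have eq: "(\<Sum>m<20. sqrt 3 ^ m / fact m) = c + sqrt 3 * d"
    using exp_partial_sum_even_odd[of "sqrt 3" 10] by (simp add: c_def d_def)
  obtain t where t: "\<bar>t\<bar> \<le> \<bar>sqrt 3\<bar>" "exp (sqrt 3) = c + sqrt 3 * d + exp t / fact 20 * sqrt 3 ^ 20"
    using Maclaurin_exp_le[of "sqrt 3" 20] unfolding eq by blast
  \<comment> \<open>Since \<open>t \<le> sqrt 3 < 2\<close>, the remainder is at most
    \<open>9 * 3^10 / 20!\<close>, which is below \<open>10^-12\<close>.\<close>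
  have "exp t \<le> exp 1 ^ 2"
    using t sqrt3_bounds by (simp flip: exp_of_nat_mult)
  also have "\<dots> \<le> 3 ^ 2"
    using exp_le by (intro power_mono) auto
  finally have "exp t \<le> 9" by simp
  moreover have "sqrt 3 ^ 20 = 3 ^ 10"
    using power_mult[of "sqrt 3" 2 10] by simp
  ultimately have tail: "exp t / fact 20 * sqrt 3 ^ 20 \<le> 1 / 10 ^ 12"
    by (simp add: fact_numeral)
  have "1.7320508075 * 1.58058656356 \<le> sqrt 3 * d"
    using c d sqrt3_bounds by (intro mult_mono) auto
  then have "5.652233672 < c + sqrt 3 * d" using c by simp
  also have "\<dots> \<le> exp (sqrt 3)" unfolding t(2) by simp
  finally show "5.652233672 < exp (sqrt 3)" .
  have "sqrt 3 * d \<le> 1.7320508076 * 1.58058656357"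
    using c d sqrt3_bounds by (intro mult_mono) auto
  moreover have "exp (sqrt 3) \<le> c + sqrt 3 * d + 1 / 10 ^ 12"
    unfolding t(2) using tail by (rule add_left_mono)
  ultimately show "exp (sqrt 3) < 5.652233675" using c by simp
qed

lemma C_TV_root:
  shows "(3 powr (1 / 4) :: real) ^ 4 = 3" "(3 powr (1 / 4) :: real)\<^sup>2 = sqrt 3"
  by (simp_all add: powr_half_sqrt flip: powr_numeral powr_powr) (simp_all add: powr_powr powr_half_sqrt)

text \<open>Squaring removes the fourth root and the root of \<open>2 * pi\<close>, leaving only
  \<open>sqrt 3\<close>, \<open>pi\<close> and \<open>exp (sqrt 3)\<close>, for which rational
  bounds are available.\<close>

lemma C_TV_squared: "C_TV\<^sup>2 = (6 * sqrt 3 + 9) / (4 * pi * exp (sqrt 3))"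
proof -
  define a :: real where "a = 3 powr (1 / 4)"
  have a2: "a\<^sup>2 = sqrt 3" using C_TV_root by (simp add: a_def)
  have "C_TV = a * (a\<^sup>2 + 3) / 2 * (exp (- sqrt 3 / 2) / sqrt (2 * pi))"
    by (simp add: C_TV_def a_def[symmetric] Let_def std_normal_density_def a2[symmetric]
        power2_eq_square power3_eq_cube algebra_simps)
  then have "C_TV\<^sup>2 = (a * (a\<^sup>2 + 3) / 2 * (exp (- sqrt 3 / 2) / sqrt (2 * pi)))\<^sup>2"
    by (rule arg_cong)
  also have "\<dots> = sqrt 3 * (sqrt 3 + 3)\<^sup>2 / 4 * ((exp (- sqrt 3 / 2))\<^sup>2 / (2 * pi))"
    by (simp add: power_mult_distrib power_divide a2)
  also have "(exp (- sqrt 3 / 2))\<^sup>2 = 1 / exp (sqrt 3)"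
    by (simp add: exp_minus field_simps flip: exp_of_nat_mult)
  also have "sqrt 3 * (sqrt 3 + 3)\<^sup>2 = 12 * sqrt 3 + 18"
    by (simp add: power2_eq_square algebra_simps)
  finally show ?thesis by (simp add: field_simps)
qed

text \<open>The radius is half a unit in the ninth decimal. The squares of both interval endpoints
  are compared with \<open>C_TV^2\<close>.\<close>

lemma C_TV_numeric: "\<bar>C_TV - 0.522516163\<bar> < 5 / 10 ^ 10"
proof -
  have pos: "0 \<le> C_TV" by (simp add: C_TV_def Let_def)
  \<comment> \<open>An upper bound on the denominator, named after the lower bound on
    \<open>C_TV\<close> that it yields; \<open>upper\<close> is the reverse.\<close>
  have lower: "pi * exp (sqrt 3) < 3.1415926535899 * 5.652233675"
    using pi_approx exp_sqrt3_bounds pi_gt_zero by (intro mult_le_less_imp_less) auto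
  have upper: "3.141592653588 * 5.652233672 < pi * exp (sqrt 3)"
    using pi_approx exp_sqrt3_bounds by (intro mult_le_less_imp_less) auto
  have "0.5225161625\<^sup>2 * (4 * (pi * exp (sqrt 3))) < 6 * sqrt 3 + 9"
    using lower sqrt3_bounds by (simp add: power2_eq_square)
  then have "0.5225161625\<^sup>2 < C_TV\<^sup>2"
    unfolding C_TV_squared by (simp add: pos_less_divide_eq mult.assoc)
  then have "0.5225161625 < C_TV" using pos by (rule power2_less_imp_less)
  moreover have "6 * sqrt 3 + 9 < 0.5225161635\<^sup>2 * (4 * (pi * exp (sqrt 3)))"
    using upper sqrt3_bounds by (simp add: power2_eq_square)
  then have "C_TV\<^sup>2 < 0.5225161635\<^sup>2"
    unfolding C_TV_squared by (simp add: pos_divide_less_eq mult.assoc)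
  then have "C_TV < 0.5225161635" by (rule power2_less_imp_less) simp
  ultimately show ?thesis unfolding abs_less_iff by simp
qed

theorem theorem5p11:
  shows "(\<lambda>n::nat. real (n - 1) * d_TV (p n) std_normal_density) \<longlonglongrightarrow> C_TV
    \<and> \<bar>C_TV - 0.522516163\<bar> < 5 / 10 ^ 10"
proof
  have "C_TV = (LINT y|lborel. \<bar>3 - y ^ 4\<bar> * std_normal_density y) / 8"
    using integral_abs_quartic[OF _ C_TV_root(1)] by (simp add: C_TV_def Let_def)
  with TV_tendsto_integral
  have "(\<lambda>N. real N * d_TV (p (Suc N)) std_normal_density) \<longlonglongrightarrow> C_TV"
    by (simp only:)
  \<comment> \<open>Shifting the index by one turns \<open>n - 1\<close> into \<open>N\<close> and
    discards \<open>n = 0\<close>, where the subtraction truncates.\<close>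
  then show "(\<lambda>n. real (n - 1) * d_TV (p n) std_normal_density) \<longlonglongrightarrow> C_TV"
    by (subst filterlim_sequentially_Suc[symmetric]) simp
qed (rule C_TV_numeric)

end
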